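(* For every positive integer $k$ there exist systems of constraints $F$ over arbitrarily large numbers $n$ of variables such that: the incidence treewidth of $F$ is $O(k)$; every d-SDNNF circuit computing $F$ has size $(n/k)^{\Omega(k)}$; and every constraint $c$ of $F$ is $O(nk)$-slim for OBDDs, i.e., for every total order $\pi$ of $\mathit{var}(c)$ there is a complete $\pi$-OBDD of width $O(nk)$ computing $c$.
   Context: A system of constraints is a finite conjunction of Boolean functions (constraints) each on a finite set of Boolean variables. Its incidence graph has the constraints and variables as vertices, with an edge between constraint $c$ and variable $x$ iff $x\in\mathit{var}(c)$; the incidence treewidth is the treewidth of this graph. A d-SDNNF circuit is a Boolean circuit with literal inputs and binary $\land$/$\lor$ gates, together with a vtree $\tau$ (rooted binary tree with leaves in bijection with the variables) and a map $\lambda$ from gates to vtree nodes such that $\mathit{var}(D_g)\subseteq\mathit{var}(\lambda(g))$ for all gates $g$ ($D_g$ the subcircuit at $g$, $\mathit{var}(t)$ the variables at leaves below $t$), $\lambda(g)=\lambda(g_1)=\lambda(g_2)$ for every $\lor$-gate $g=g_1\lor g_2$, for every $\land$-gate $g=g_1\land g_2$ the node $\lambda(g)$ has children $t_1,t_2$ with $\lambda(g_i)$ below $t_i$, and for every $\lor$-gate $g_1\lor g_2$ no assignment satisfies both $D_{g_1}$ and $D_{g_2}$. Size is the number of gates and wires. A $\pi$-OBDD is a binary decision diagram (DAG with one source, sinks $0$ and $1$, internal decision nodes labelled by variables with a $0$-child and a $1$-child) in which variables appear at most once and in an order consistent with $\pi$ along every root-to-sink path; it is complete if every such path contains all variables.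 Its width is the maximum number of nodes labelled by the same variable. *)

theory Defs
  imports Complex_Main "HOL-Library.Sublist"
begin

subsection \<open>Systems of constraints\<close>

record 'v constraint =
  cvar :: "'v set"
  cfun :: "('v \<Rightarrow> bool) \<Rightarrow> bool"

text \<open>A Boolean function on \<open>cvar c\<close> is given on total assignments and must ignore all
  variables outside \<open>cvar c\<close>.  It need not depend on every variable in \<open>cvar c\<close>.\<close>

definition is_constraint :: "'v constraint \<Rightarrow> bool" where
  "is_constraint c \<longleftrightarrow> finite (cvar c) \<and>
     (\<forall>a b. (\<forall>x\<in>cvar c. a x = b x) \<longrightarrow> cfun c a = cfun c b)"

definition is_system :: "'v constraint set \<Rightarrow> bool" where
  "is_system F \<longleftrightarrow> finite F \<and> (\<forall>c\<in>F. is_constraint c)"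

definition system_vars :: "'v constraint set \<Rightarrow> 'v set" where
  "system_vars F = (\<Union>c\<in>F. cvar c)"

definition system_sat :: "'v constraint set \<Rightarrow> ('v \<Rightarrow> bool) \<Rightarrow> bool" where
  "system_sat F a \<longleftrightarrow> (\<forall>c\<in>F. cfun c a)"


subsection \<open>Treewidth\<close>

text \<open>Undirected graphs are given by a vertex set and a set of two-element edges.\<close>

definition simple_graph :: "'a set \<Rightarrow> 'a set set \<Rightarrow> bool" where
  "simple_graph V E \<longleftrightarrow> (\<forall>e\<in>E. \<exists>u\<in>V. \<exists>v\<in>V. u \<noteq> v \<and> e = {u, v})"

definition connected_within :: "'a set set \<Rightarrow> 'a set \<Rightarrow> bool" where
  "connected_within E S \<longleftrightarrow> (\<forall>u\<in>S. \<forall>v\<in>S. \<exists>xs. xs \<noteq> [] \<and> hd xs = u \<and> last xs = v \<and>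
     set xs \<subseteq> S \<and> successively (\<lambda>x y. {x, y} \<in> E) xs)"

definition is_cycle :: "'a set set \<Rightarrow> 'a list \<Rightarrow> bool" where
  "is_cycle E xs \<longleftrightarrow> length xs \<ge> 3 \<and> distinct xs \<and>
     successively (\<lambda>x y. {x, y} \<in> E) xs \<and> {last xs, hd xs} \<in> E"

definition is_tree :: "'a set \<Rightarrow> 'a set set \<Rightarrow> bool" where
  "is_tree V E \<longleftrightarrow> finite V \<and> V \<noteq> {} \<and> simple_graph V E \<and> connected_within E V \<and>
     (\<nexists>xs. is_cycle E xs)"

definition is_tree_decomposition ::
    "'a set \<Rightarrow> 'a set set \<Rightarrow> 't set \<Rightarrow> 't set set \<Rightarrow> ('t \<Rightarrow> 'a set) \<Rightarrow> bool" where
  "is_tree_decomposition V E T A bag \<longleftrightarrow> is_tree T A \<and>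
     (\<forall>t\<in>T. bag t \<subseteq> V) \<and>
     (\<forall>v\<in>V. \<exists>t\<in>T. v \<in> bag t) \<and>
     (\<forall>e\<in>E. \<exists>t\<in>T. e \<subseteq> bag t) \<and>
     (\<forall>v\<in>V. connected_within A {t \<in> T. v \<in> bag t})"

definition decomposition_width :: "'t set \<Rightarrow> ('t \<Rightarrow> 'a set) \<Rightarrow> nat" where
  "decomposition_width T bag = Max ((\<lambda>t. card (bag t)) ` T) - 1"

text \<open>Decomposition trees are finite, so natural numbers suffice as their nodes.\<close>

definition treewidth :: "'a set \<Rightarrow> 'a set set \<Rightarrow> nat" where
  "treewidth V E = (LEAST w. \<exists>(T :: nat set) A bag.
     is_tree_decomposition V E T A bag \<and> decomposition_width T bag = w)"

definition incidence_vertices :: "'v constraint set \<Rightarrow> ('v constraint + 'v) set" where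
  "incidence_vertices F = Inl ` F \<union> Inr ` system_vars F"

definition incidence_edges :: "'v constraint set \<Rightarrow> ('v constraint + 'v) set set" where
  "incidence_edges F = {{Inl c, Inr x} | c x. c \<in> F \<and> x \<in> cvar c}"

definition incidence_treewidth :: "'v constraint set \<Rightarrow> nat" where
  "incidence_treewidth F = treewidth (incidence_vertices F) (incidence_edges F)"


subsection \<open>Deterministic structured DNNF circuits\<close>

datatype 'v vtree = VLeaf 'v | VNode "'v vtree" "'v vtree"

fun vtree_leaves :: "'v vtree \<Rightarrow> 'v list" where
  "vtree_leaves (VLeaf x) = [x]"
| "vtree_leaves (VNode l r) = vtree_leaves l @ vtree_leaves r"

text \<open>As the leaves of a vtree are pairwise distinct, its nodes correspond one-to-one to the
  subtrees below them; a node is represented by that subtree, and \<open>s\<close> is below \<open>t\<close> (possibly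
  equal to it) iff \<open>s \<in> subtrees t\<close>.\<close>

fun subtrees :: "'v vtree \<Rightarrow> 'v vtree set" where
  "subtrees (VLeaf x) = {VLeaf x}"
| "subtrees (VNode l r) = insert (VNode l r) (subtrees l \<union> subtrees r)"

definition vtree_on :: "'v set \<Rightarrow> 'v vtree \<Rightarrow> bool" where
  "vtree_on X t \<longleftrightarrow> distinct (vtree_leaves t) \<and> set (vtree_leaves t) = X"

text \<open>\<open>Lit x True\<close> is the literal \<open>x\<close>, \<open>Lit x False\<close> its negation.  There are no constant
  inputs; hence no deterministic structured DNNF circuit computes an unsatisfiable function.\<close>

datatype ('v, 'g) gate = Lit 'v bool | And 'g 'g | Or 'g 'g

fun gate_inputs :: "('v, 'g) gate \<Rightarrow> 'g list" where
  "gate_inputs (Lit x b) = []"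
| "gate_inputs (And g h) = [g, h]"
| "gate_inputs (Or g h) = [g, h]"

record ('v, 'g) circuit =
  gates :: "'g set"
  gate :: "'g \<Rightarrow> ('v, 'g) gate"
  output_gate :: 'g

definition wires :: "('v, 'g) circuit \<Rightarrow> ('g \<times> 'g) set" where
  "wires D = {(h, g). g \<in> gates D \<and> h \<in> set (gate_inputs (gate D g))}"

definition is_circuit :: "('v, 'g) circuit \<Rightarrow> bool" where
  "is_circuit D \<longleftrightarrow> finite (gates D) \<and> output_gate D \<in> gates D \<and>
     (\<forall>g\<in>gates D. set (gate_inputs (gate D g)) \<subseteq> gates D) \<and> acyclic (wires D)"

definition circuit_size :: "('v, 'g) circuit \<Rightarrow> nat" where
  "circuit_size D = card (gates D) + (\<Sum>g\<in>gates D. length (gate_inputs (gate D g)))"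

text \<open>\<open>gate_sat D a g\<close> says that the assignment \<open>a\<close> satisfies the subcircuit at \<open>g\<close>; all gates
  are monotone in their inputs, so the least fixed point is the usual evaluation.\<close>

inductive gate_sat :: "('v, 'g) circuit \<Rightarrow> ('v \<Rightarrow> bool) \<Rightarrow> 'g \<Rightarrow> bool"
  for D :: "('v, 'g) circuit" and a :: "'v \<Rightarrow> bool" where
  "gate D g = Lit x b \<Longrightarrow> a x = b \<Longrightarrow> gate_sat D a g"
| "gate D g = And h1 h2 \<Longrightarrow> gate_sat D a h1 \<Longrightarrow> gate_sat D a h2 \<Longrightarrow> gate_sat D a g"
| "gate D g = Or h1 h2 \<Longrightarrow> gate_sat D a h1 \<Longrightarrow> gate_sat D a g"
| "gate D g = Or h1 h2 \<Longrightarrow> gate_sat D a h2 \<Longrightarrow> gate_sat D a g"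

definition gate_vars :: "('v, 'g) circuit \<Rightarrow> 'g \<Rightarrow> 'v set" where
  "gate_vars D g = {x. \<exists>h b. (h, g) \<in> (wires D)\<^sup>* \<and> gate D h = Lit x b}"

text \<open>The children of a vtree node are unordered, so the two inputs of an \<open>And\<close>-gate may be
  matched with them in either way.\<close>

definition is_d_SDNNF ::
    "'v set \<Rightarrow> ('v, 'g) circuit \<Rightarrow> 'v vtree \<Rightarrow> ('g \<Rightarrow> 'v vtree) \<Rightarrow> bool" where
  "is_d_SDNNF X D \<tau> lam \<longleftrightarrow> is_circuit D \<and> vtree_on X \<tau> \<and>
     (\<forall>g\<in>gates D. lam g \<in> subtrees \<tau> \<and> gate_vars D g \<subseteq> set (vtree_leaves (lam g))) \<and>
     (\<forall>g\<in>gates D. \<forall>g1 g2. gate D g = Or g1 g2 \<longrightarrow> lam g = lam g1 \<and> lam g = lam g2) \<and>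
     (\<forall>g\<in>gates D. \<forall>g1 g2. gate D g = And g1 g2 \<longrightarrow>
        (\<exists>t1 t2. (lam g = VNode t1 t2 \<or> lam g = VNode t2 t1) \<and>
           lam g1 \<in> subtrees t1 \<and> lam g2 \<in> subtrees t2)) \<and>
     (\<forall>g\<in>gates D. \<forall>g1 g2. gate D g = Or g1 g2 \<longrightarrow>
        (\<nexists>a. gate_sat D a g1 \<and> gate_sat D a g2))"

definition d_SDNNF_computes ::
    "('v, 'g) circuit \<Rightarrow> 'v vtree \<Rightarrow> ('g \<Rightarrow> 'v vtree) \<Rightarrow> 'v constraint set \<Rightarrow> bool" where
  "d_SDNNF_computes D \<tau> lam F \<longleftrightarrow> is_d_SDNNF (system_vars F) D \<tau> lam \<and>
     (\<forall>a. gate_sat D a (output_gate D) \<longleftrightarrow> system_sat F a)"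


subsection \<open>Binary decision diagrams\<close>

text \<open>The nodes of a diagram are the two sinks and the decision nodes \<open>Inner v\<close> for
  \<open>v \<in> dnodes B\<close>.\<close>

datatype 'n bdd_node = Sink bool | Inner 'n

record ('v, 'n) bdd =
  dnodes :: "'n set"
  dlabel :: "'n \<Rightarrow> 'v"
  dchild :: "'n \<Rightarrow> bool \<Rightarrow> 'n bdd_node"
  bdd_root :: "'n bdd_node"

definition bdd_edges :: "('v, 'n) bdd \<Rightarrow> ('n \<times> 'n) set" where
  "bdd_edges B = {(u, v). u \<in> dnodes B \<and> (\<exists>b. dchild B u b = Inner v)}"

text \<open>The root is the only source, except that a sink not occurring in the diagram (when it
  computes a constant function) is disregarded.\<close>

definition is_bdd :: "('v, 'n) bdd \<Rightarrow> bool" where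
  "is_bdd B \<longleftrightarrow> finite (dnodes B) \<and> acyclic (bdd_edges B) \<and> Range (bdd_edges B) \<subseteq> dnodes B \<and>
     (\<forall>v. bdd_root B = Inner v \<longrightarrow> v \<in> dnodes B) \<and>
     {v \<in> dnodes B. v \<notin> Range (bdd_edges B)} = {v. bdd_root B = Inner v}"

text \<open>\<open>bdd_path B u p s\<close>: there is a path from \<open>u\<close> to the sink \<open>s\<close> that tests the variables
  \<open>map fst p\<close> in this order, with outcomes \<open>map snd p\<close>.\<close>

inductive bdd_path :: "('v, 'n) bdd \<Rightarrow> 'n bdd_node \<Rightarrow> ('v \<times> bool) list \<Rightarrow> bool \<Rightarrow> bool"
  for B :: "('v, 'n) bdd" where
  "bdd_path B (Sink s) [] s"
| "v \<in> dnodes B \<Longrightarrow> bdd_path B (dchild B v b) p s \<Longrightarrow> bdd_path B (Inner v) ((dlabel B v, b) # p) s"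

text \<open>A total order of a finite set is given as the duplicate-free list of its elements.\<close>

definition is_OBDD :: "'v list \<Rightarrow> ('v, 'n) bdd \<Rightarrow> bool" where
  "is_OBDD \<pi> B \<longleftrightarrow> is_bdd B \<and> (\<forall>p s. bdd_path B (bdd_root B) p s \<longrightarrow> subseq (map fst p) \<pi>)"

definition is_complete_OBDD :: "'v list \<Rightarrow> ('v, 'n) bdd \<Rightarrow> bool" where
  "is_complete_OBDD \<pi> B \<longleftrightarrow> is_OBDD \<pi> B \<and>
     (\<forall>p s. bdd_path B (bdd_root B) p s \<longrightarrow> set \<pi> \<subseteq> fst ` set p)"

definition bdd_accepts :: "('v, 'n) bdd \<Rightarrow> ('v \<Rightarrow> bool) \<Rightarrow> bool" where
  "bdd_accepts B a \<longleftrightarrow> (\<exists>p. bdd_path B (bdd_root B) p True \<and> (\<forall>(x, b)\<in>set p. a x = b))"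

definition bdd_width :: "('v, 'n) bdd \<Rightarrow> nat" where
  "bdd_width B = Max (insert 0 ((\<lambda>x. card {v \<in> dnodes B. dlabel B v = x}) ` dlabel B ` dnodes B))"

definition slim_for_OBDDs :: "nat \<Rightarrow> 'v constraint \<Rightarrow> bool" where
  "slim_for_OBDDs w c \<longleftrightarrow> (\<forall>\<pi>. distinct \<pi> \<and> set \<pi> = cvar c \<longrightarrow>
     (\<exists>B :: ('v, nat) bdd. is_complete_OBDD \<pi> B \<and> bdd_width B \<le> w \<and>
        (\<forall>a. bdd_accepts B a \<longleftrightarrow> cfun c a)))"

end

theory Submission
  imports Defs "HOL-Library.Countable" "HOL-Library.FuncSet" "HOL-Library.Function_Algebras"
    "HOL-Number_Theory.Cong"
begin

text \<open>
  The variables are \<open>6p\<close> parallel copies of every arc \<open>(i, j)\<close> on \<open>7k\<close> vertices, loops included,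
  and the constraints, one per vertex, say that the selected arcs form a circulation modulo \<open>p\<close>.
  The vertices of the incidence graph that are constraints form a vertex cover of size \<open>7k\<close>, which
  bounds the treewidth, and each constraint is decided in any variable order by a counter modulo
  \<open>p\<close>.

  For the lower bound take a vtree node that splits the variables in a balanced way. Call an arc
  frequent on a side if at least \<open>p\<close> of its copies lie there. Subsets of a side then realise,
  modulo \<open>p\<close>, all integer combinations of its frequent arcs. Every arc is frequent on some side,
  and a graph or its complement is connected, so the frequent arcs of one side span all arcs; by
  counting, those of the other side contain a star with \<open>k\<close> leaves. Hence both sides realise the
  \<open>p\<^sup>k\<close> combinations of the arcs of that star. Pairing each with its negative gives \<open>p\<^sup>k\<close> models
  no two of which can be recombined across the split. Two models that pass through the same gate
  at the vtree node could be recombined, so there are at least \<open>p\<^sup>k\<close> gates.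
\<close>


section \<open>Treewidth and vertex covers\<close>

definition star_edges :: "'a \<Rightarrow> 'a set \<Rightarrow> 'a set set" where
  "star_edges c L = (\<lambda>l. {c, l}) ` L"

lemma star_edges_iff: "{x, y} \<in> star_edges c L \<longleftrightarrow> x = c \<and> y \<in> L \<or> y = c \<and> x \<in> L"
  by (auto simp: star_edges_def doubleton_eq_iff)

lemma connected_within_star: "connected_within (star_edges c L) (insert c L)"
  unfolding connected_within_def
proof (intro ballI)
  fix u v assume uv: "u \<in> insert c L" "v \<in> insert c L"
  consider "u = v" | "u \<noteq> v" "u = c \<or> v = c" | "u \<noteq> c" "v \<noteq> c" by blast
  then show "\<exists>xs. xs \<noteq> [] \<and> hd xs = u \<and> last xs = v \<and> set xs \<subseteq> insert c L \<and>
    successively (\<lambda>x y. {x, y} \<in> star_edges c L) xs"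
  proof cases
    case 1
    then show ?thesis using uv by (intro exI[of _ "[u]"]) auto
  next
    case 2
    then show ?thesis using uv by (intro exI[of _ "[u, v]"]) (auto simp: star_edges_iff)
  next
    case 3
    then show ?thesis using uv by (intro exI[of _ "[u, c, v]"]) (auto simp: star_edges_iff)
  qed
qed

lemma not_is_cycle_star: "\<not> is_cycle (star_edges c L) xs"
proof
  assume cycle: "is_cycle (star_edges c L) xs"
  then have "length xs \<ge> 3" by (simp add: is_cycle_def)
  then obtain x y z ys where xs: "xs = x # y # z # ys"
    by (metis One_nat_def Suc_le_length_iff numeral_3_eq_3)
  have "y = c" using cycle unfolding xs is_cycle_def by (auto simp: star_edges_iff)
  then show False
    using cycle unfolding xs is_cycle_def by (cases ys) (auto simp: star_edges_iff)
qed

lemma is_tree_star: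
  assumes "finite L" "c \<notin> L"
  shows "is_tree (insert c L) (star_edges c L)"
proof -
  have "simple_graph (insert c L) (star_edges c L)"
    using assms(2) by (force simp: simple_graph_def star_edges_def)
  then show ?thesis
    using assms(1) by (simp add: is_tree_def connected_within_star not_is_cycle_star)
qed

lemma connected_within_singleton: "connected_within E {t}"
  unfolding connected_within_def by (intro ballI exI[of _ "[t]"]) simp

lemma edge_subset_insert_vertex_cover:
  assumes "simple_graph V E" "e \<in> E" "e \<inter> C \<noteq> {}"
  shows "\<exists>v\<in>V. e \<subseteq> insert v C"
proof -
  obtain u v where "e = {u, v}" "u \<in> V" "v \<in> V"
    using assms(1,2) unfolding simple_graph_def by meson
  then show ?thesis using assms(3) by auto
qed

lemma is_tree_decomposition_vertex_cover:
  assumes graph: "simple_graph V E" and cover: "\<And>e. e \<in> E \<Longrightarrow> e \<inter> C \<noteq> {}" and "C \<subseteq> V"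
    and L: "finite L" "z \<notin> L" and f: "bij_betw f L (V - C)"
  shows "is_tree_decomposition V E (insert z L) (star_edges z L)
    (\<lambda>t. if t = z then C else insert (f t) C)" (is "is_tree_decomposition V E ?T ?A ?bag")
proof -
  have tree: "is_tree ?T ?A" using L by (rule is_tree_star)
  have f_in: "f l \<in> V - C" if "l \<in> L" for l using f that by (auto simp: bij_betw_def)
  have f_onto: "\<exists>l\<in>L. f l = v" if "v \<in> V - C" for v
    using f that by (metis bij_betw_imp_surj_on imageE)
  have covered: "\<exists>t\<in>?T. insert v C \<subseteq> ?bag t" if "v \<in> V" for v
  proof (cases "v \<in> C")
    case True
    then show ?thesis by (intro bexI[of _ z]) auto
  next
    case False
    then obtain l where "l \<in> L" "f l = v" using f_onto \<open>v \<in> V\<close> by blast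
    then show ?thesis using L(2) by (intro bexI[of _ l]) auto
  qed
  moreover have "\<exists>v\<in>V. e \<subseteq> insert v C" if "e \<in> E" for e
    using graph that cover[OF that] by (rule edge_subset_insert_vertex_cover)
  ultimately have "\<forall>e\<in>E. \<exists>t\<in>?T. e \<subseteq> ?bag t" by (meson order_trans)
  moreover have "connected_within ?A {t \<in> ?T. v \<in> ?bag t}" if "v \<in> V" for v
  proof (cases "v \<in> C")
    case True
    then have "{t \<in> ?T. v \<in> ?bag t} = ?T" by auto
    then show ?thesis by (simp only: connected_within_star)
  next
    case False
    then obtain l where l: "l \<in> L" "f l = v" using f_onto \<open>v \<in> V\<close> by blast
    have "{t \<in> ?T. v \<in> ?bag t} = {t \<in> L. f t = f l}" using False l L(2) by auto
    also have "\<dots> = {l}" using l(1) f by (auto simp: bij_betw_def inj_on_eq_iff)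
    finally show ?thesis by (simp only: connected_within_singleton)
  qed
  moreover have "\<forall>t\<in>?T. ?bag t \<subseteq> V" using f_in \<open>C \<subseteq> V\<close> by auto
  moreover have "\<forall>v\<in>V. \<exists>t\<in>?T. v \<in> ?bag t" using covered by blast
  ultimately show ?thesis using tree unfolding is_tree_decomposition_def by blast
qed

lemma treewidth_le_card_vertex_cover:
  assumes "finite V" "simple_graph V E" "C \<subseteq> V" "\<And>e. e \<in> E \<Longrightarrow> e \<inter> C \<noteq> {}"
  shows "treewidth V E \<le> card C"
proof -
  have "finite C" using assms(1,3) by (rule rev_finite_subset)
  obtain f where f: "bij_betw f {1..card (V - C)} (V - C)"
    using ex_bij_betw_nat_finite_1[of "V - C"] assms(1) by blast
  let ?T = "insert 0 {1..card (V - C)}" and ?bag = "\<lambda>t. if t = 0 then C else insert (f t) C"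
  have "treewidth V E \<le> decomposition_width ?T ?bag"
    unfolding treewidth_def
    using is_tree_decomposition_vertex_cover[OF assms(2,4,3) _ _ f, of 0]
    by (intro Least_le) auto
  also have "\<dots> \<le> card C"
  proof -
    have "Max ((\<lambda>t. card (?bag t)) ` ?T) \<le> Suc (card C)"
      by (rule Max.boundedI) (use \<open>finite C\<close> in \<open>auto simp: card_insert_if\<close>)
    then show ?thesis unfolding decomposition_width_def by linarith
  qed
  finally show ?thesis .
qed

lemma incidence_treewidth_le_card:
  assumes "is_system F"
  shows "incidence_treewidth F \<le> card F"
proof -
  have "incidence_treewidth F \<le> card (Inl ` F :: ('a constraint + 'a) set)"
    unfolding incidence_treewidth_def
  proof (rule treewidth_le_card_vertex_cover)
    show "finite (incidence_vertices F)"
      using assms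
      by (auto simp: is_system_def is_constraint_def incidence_vertices_def system_vars_def)
    show "simple_graph (incidence_vertices F) (incidence_edges F)"
      by (fastforce simp: simple_graph_def incidence_vertices_def incidence_edges_def
          system_vars_def)
  qed (auto simp: incidence_vertices_def incidence_edges_def)
  then show ?thesis by (simp add: card_image)
qed


section \<open>Decision diagrams simulating automata\<close>

lemma slim_for_OBDDs_mono: "slim_for_OBDDs v c \<Longrightarrow> v \<le> w \<Longrightarrow> slim_for_OBDDs w c"
  unfolding slim_for_OBDDs_def by (meson le_trans)

locale variable_automaton =
  fixes states :: "'s::countable set" and \<delta> :: "'v \<Rightarrow> bool \<Rightarrow> 's \<Rightarrow> 's"
    and init :: 's and accepting :: "'s \<Rightarrow> bool"
  assumes finite_states: "finite states"
    and init_in_states: "init \<in> states"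
    and step_in_states: "s \<in> states \<Longrightarrow> \<delta> x b s \<in> states"
begin

primrec reachable :: "'v list \<Rightarrow> nat \<Rightarrow> 's set" where
  "reachable \<pi> 0 = {init}"
| "reachable \<pi> (Suc i) = {\<delta> (\<pi> ! i) b s | b s. s \<in> reachable \<pi> i}"

definition level_node :: "'v list \<Rightarrow> nat \<Rightarrow> 's \<Rightarrow> nat bdd_node" where
  "level_node \<pi> i s = (if i < length \<pi> then Inner (to_nat (i, s)) else Sink (accepting s))"

text \<open>Unreachable states are left out because the root of a diagram has to be its only source.\<close>

definition simulating_bdd :: "'v list \<Rightarrow> ('v, nat) bdd" where
  "simulating_bdd \<pi> =
     \<lparr>dnodes = {to_nat (i, s) | i s. i < length \<pi> \<and> s \<in> reachable \<pi> i},
      dlabel = (\<lambda>v. case from_nat v of (i, s :: 's) \<Rightarrow> \<pi> ! i),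
      dchild = (\<lambda>v b. case from_nat v of (i, s) \<Rightarrow> level_node \<pi> (Suc i) (\<delta> (\<pi> ! i) b s)),
      bdd_root = level_node \<pi> 0 init\<rparr>"

lemma reachable_subset_states: "reachable \<pi> i \<subseteq> states"
  by (induction i) (auto intro: init_in_states step_in_states)

lemma dnodes_simulating_bdd:
  "v \<in> dnodes (simulating_bdd \<pi>) \<longleftrightarrow> (\<exists>i s. v = to_nat (i, s) \<and> i < length \<pi> \<and> s \<in> reachable \<pi> i)"
  by (auto simp: simulating_bdd_def)

lemma finite_dnodes_simulating_bdd: "finite (dnodes (simulating_bdd \<pi>))"
proof (rule finite_subset)
  show "dnodes (simulating_bdd \<pi>) \<subseteq> to_nat ` ({..<length \<pi>} \<times> states)"
    using reachable_subset_states by (fastforce simp: dnodes_simulating_bdd)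
qed (simp add: finite_states)

lemma dlabel_simulating_bdd: "dlabel (simulating_bdd \<pi>) (to_nat (i, s :: 's)) = \<pi> ! i"
  by (simp add: simulating_bdd_def)

lemma dchild_simulating_bdd:
  "dchild (simulating_bdd \<pi>) (to_nat (i, s)) b = level_node \<pi> (Suc i) (\<delta> (\<pi> ! i) b s)"
  by (simp add: simulating_bdd_def)

lemma bdd_root_simulating_bdd: "bdd_root (simulating_bdd \<pi>) = level_node \<pi> 0 init"
  by (simp add: simulating_bdd_def)

lemma bdd_edges_simulating_bdd:
  "(u, v) \<in> bdd_edges (simulating_bdd \<pi>) \<longleftrightarrow> (\<exists>i s b. Suc i < length \<pi> \<and> s \<in> reachable \<pi> i \<and>
     u = to_nat (i, s) \<and> v = to_nat (Suc i, \<delta> (\<pi> ! i) b s))"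
  by (fastforce simp: bdd_edges_def dnodes_simulating_bdd dchild_simulating_bdd level_node_def
      split: if_splits)

lemma acyclic_simulating_bdd: "acyclic (bdd_edges (simulating_bdd \<pi>))"
proof (rule acyclicI_order)
  define level where "level v = fst (from_nat v :: nat \<times> 's)" for v
  fix u v assume "(u, v) \<in> bdd_edges (simulating_bdd \<pi>)"
  then show "- int (level v) < - int (level u)"
    by (auto simp: bdd_edges_simulating_bdd level_def)
qed

lemma Range_edges_simulating_bdd:
  "v \<in> Range (bdd_edges (simulating_bdd \<pi>)) \<longleftrightarrow>
     (\<exists>i s. v = to_nat (Suc i, s) \<and> Suc i < length \<pi> \<and> s \<in> reachable \<pi> (Suc i))"
  by (fastforce simp: Range_iff bdd_edges_simulating_bdd)

lemma is_bdd_simulating_bdd: "is_bdd (simulating_bdd \<pi>)"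
proof -
  let ?B = "simulating_bdd \<pi>"
  have root: "bdd_root ?B = Inner v \<longleftrightarrow> v = to_nat (0 :: nat, init) \<and> \<pi> \<noteq> []" for v
    by (auto simp: bdd_root_simulating_bdd level_node_def)
  have "v \<in> dnodes ?B \<and> v \<notin> Range (bdd_edges ?B) \<longleftrightarrow> bdd_root ?B = Inner v" for v
  proof
    assume v: "v \<in> dnodes ?B \<and> v \<notin> Range (bdd_edges ?B)"
    then obtain i s where node: "v = to_nat (i, s)" "i < length \<pi>" "s \<in> reachable \<pi> i"
      unfolding dnodes_simulating_bdd by blast
    with v have "i = 0"
      by (cases i) (auto simp del: reachable.simps simp: Range_edges_simulating_bdd)
    with node show "bdd_root ?B = Inner v" by (auto simp: root)
  qed (auto simp: root dnodes_simulating_bdd Range_edges_simulating_bdd)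
  moreover have "Range (bdd_edges ?B) \<subseteq> dnodes ?B"
    unfolding dnodes_simulating_bdd Range_edges_simulating_bdd subset_iff by blast
  ultimately show ?thesis
    unfolding is_bdd_def using finite_dnodes_simulating_bdd acyclic_simulating_bdd by blast
qed

lemma bdd_path_level_node:
  assumes "i \<le> length \<pi>" "s \<in> reachable \<pi> i"
  shows "bdd_path (simulating_bdd \<pi>) (level_node \<pi> i s) q r \<longleftrightarrow>
    map fst q = drop i \<pi> \<and> r = accepting (fold (\<lambda>(x, b). \<delta> x b) q s)"
  using assms
proof (induction i arbitrary: s q rule: inc_induct)
  case base
  show ?case by (subst bdd_path.simps) (auto simp: level_node_def)
next
  case (step i)
  let ?B = "simulating_bdd \<pi>" and ?succ = "\<lambda>b. \<delta> (\<pi> ! i) b s"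
  have node: "to_nat (i, s) \<in> dnodes ?B" using step by (auto simp: dnodes_simulating_bdd)
  have succ: "?succ b \<in> reachable \<pi> (Suc i)" for b using step by auto
  have "bdd_path ?B (level_node \<pi> i s) q r \<longleftrightarrow>
      (\<exists>b q'. q = (\<pi> ! i, b) # q' \<and> bdd_path ?B (level_node \<pi> (Suc i) (?succ b)) q' r)"
    using step.hyps node unfolding level_node_def[of \<pi> i]
    by (subst bdd_path.simps) (auto simp: dlabel_simulating_bdd dchild_simulating_bdd)
  also have "\<dots> \<longleftrightarrow> (\<exists>b q'. q = (\<pi> ! i, b) # q' \<and> map fst q' = drop (Suc i) \<pi> \<and>
      r = accepting (fold (\<lambda>(x, b). \<delta> x b) q' (?succ b)))"
    using step.IH[OF succ] by blast
  also have "\<dots> \<longleftrightarrow> map fst q = \<pi> ! i # drop (Suc i) \<pi> \<and>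
      r = accepting (fold (\<lambda>(x, b). \<delta> x b) q s)"
    by (cases q) auto
  finally show ?case using step.hyps by (simp add: Cons_nth_drop_Suc)
qed

lemma bdd_path_simulating_bdd:
  "bdd_path (simulating_bdd \<pi>) (bdd_root (simulating_bdd \<pi>)) q r \<longleftrightarrow>
     map fst q = \<pi> \<and> r = accepting (fold (\<lambda>(x, b). \<delta> x b) q init)"
  by (simp add: bdd_root_simulating_bdd bdd_path_level_node)

lemma is_complete_OBDD_simulating_bdd: "is_complete_OBDD \<pi> (simulating_bdd \<pi>)"
  unfolding is_complete_OBDD_def is_OBDD_def
  by (auto simp: is_bdd_simulating_bdd bdd_path_simulating_bdd simp flip: set_map)

lemma bdd_width_simulating_bdd:
  assumes "distinct \<pi>"
  shows "bdd_width (simulating_bdd \<pi>) \<le> card states"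
proof -
  let ?B = "simulating_bdd \<pi>"
  have "card {v \<in> dnodes ?B. dlabel ?B v = dlabel ?B u} \<le> card states" if u: "u \<in> dnodes ?B" for u
  proof -
    obtain i s where i: "u = to_nat (i, s :: 's)" "i < length \<pi>"
      using u by (auto simp: dnodes_simulating_bdd)
    have "{v \<in> dnodes ?B. dlabel ?B v = dlabel ?B u} \<subseteq> (\<lambda>s. to_nat (i, s)) ` states"
      using assms i reachable_subset_states
      by (fastforce simp: dnodes_simulating_bdd dlabel_simulating_bdd nth_eq_iff_index_eq)
    then show ?thesis by (rule surj_card_le[OF finite_states])
  qed
  then show ?thesis
    unfolding bdd_width_def using finite_dnodes_simulating_bdd by (subst Max_le_iff) auto
qed

lemma bdd_accepts_simulating_bdd:
  "bdd_accepts (simulating_bdd \<pi>) a \<longleftrightarrow> accepting (fold (\<lambda>x. \<delta> x (a x)) \<pi> init)"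
proof -
  have assigned: "map fst q = \<pi> \<and> (\<forall>(x, b)\<in>set q. a x = b) \<longleftrightarrow> q = map (\<lambda>x. (x, a x)) \<pi>" for q
  proof
    assume q: "map fst q = \<pi> \<and> (\<forall>(x, b)\<in>set q. a x = b)"
    then have "map (\<lambda>x. (x, a x)) \<pi> = map (\<lambda>z. (fst z, a (fst z))) q" by auto
    also have "\<dots> = q" using q by (intro map_idI) auto
    finally show "q = map (\<lambda>x. (x, a x)) \<pi>" ..
  qed (auto simp: comp_def)
  have "bdd_accepts (simulating_bdd \<pi>) a \<longleftrightarrow>
      (\<exists>q. (map fst q = \<pi> \<and> (\<forall>(x, b)\<in>set q. a x = b)) \<and> accepting (fold (\<lambda>(x, b). \<delta> x b) q init))"
    unfolding bdd_accepts_def bdd_path_simulating_bdd by blast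
  also have "\<dots> \<longleftrightarrow> accepting (fold (\<lambda>x. \<delta> x (a x)) \<pi> init)"
    unfolding assigned by (simp add: fold_map comp_def)
  finally show ?thesis .
qed

lemma slim_for_OBDDs_card_states:
  assumes "\<And>\<pi> a. distinct \<pi> \<Longrightarrow> set \<pi> = cvar c \<Longrightarrow>
    cfun c a \<longleftrightarrow> accepting (fold (\<lambda>x. \<delta> x (a x)) \<pi> init)"
  shows "slim_for_OBDDs (card states) c"
  unfolding slim_for_OBDDs_def
proof (intro allI impI exI conjI)
  fix \<pi> a assume \<pi>: "distinct \<pi> \<and> set \<pi> = cvar c"
  then show "bdd_width (simulating_bdd \<pi>) \<le> card states"
    by (simp add: bdd_width_simulating_bdd)
  show "bdd_accepts (simulating_bdd \<pi>) a \<longleftrightarrow> cfun c a"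
    using assms \<pi> bdd_accepts_simulating_bdd by metis
qed (rule is_complete_OBDD_simulating_bdd)

end


section \<open>Fooling sets for structured circuits\<close>

lemma subtrees_refl: "t \<in> subtrees t"
  by (cases t) auto

lemma subtrees_leaves_subset: "s \<in> subtrees t \<Longrightarrow> set (vtree_leaves s) \<subseteq> set (vtree_leaves t)"
  by (induction t) auto

lemma subtrees_distinct_leaves:
  "s \<in> subtrees t \<Longrightarrow> distinct (vtree_leaves t) \<Longrightarrow> distinct (vtree_leaves s)"
  by (induction t) auto

lemma subtrees_nested_or_disjoint:
  assumes "distinct (vtree_leaves u)" "s \<in> subtrees u" "t \<in> subtrees u"
  shows "s \<in> subtrees t \<or> t \<in> subtrees s \<or> set (vtree_leaves s) \<inter> set (vtree_leaves t) = {}"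
  using assms
proof (induction u)
  case (VNode l r)
  have "set (vtree_leaves v) \<inter> set (vtree_leaves v') = {}"
    if "v \<in> subtrees l" "v' \<in> subtrees r" for v v'
    using VNode.prems(1) that[THEN subtrees_leaves_subset] by auto
  then show ?case using VNode by auto
qed simp

lemma ex_balanced_subtree:
  assumes "n \<ge> 2" "2 * n < 3 * length (vtree_leaves u)"
  shows "\<exists>t\<in>subtrees u. n \<le> 3 * length (vtree_leaves t) \<and> 3 * length (vtree_leaves t) \<le> 2 * n"
  using assms(2)
proof (induction u)
  case (VLeaf x)
  then show ?case using assms(1) by simp
next
  case (VNode l r)
  consider "2 * n < 3 * length (vtree_leaves l)" | "2 * n < 3 * length (vtree_leaves r)"
    | "3 * length (vtree_leaves l) \<le> 2 * n" "n \<le> 3 * length (vtree_leaves l)"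
    | "3 * length (vtree_leaves r) \<le> 2 * n" "n \<le> 3 * length (vtree_leaves r)"
    using VNode.prems by force
  then show ?case
    using VNode.IH by cases (use subtrees_refl[of l] subtrees_refl[of r] in auto)
qed

lemma obtain_balanced_cut:
  assumes "vtree_on X \<tau>" "card X \<ge> 2"
  obtains t where "t \<in> subtrees \<tau>" "card X \<le> 3 * card (set (vtree_leaves t))"
    "card X \<le> 3 * card (X - set (vtree_leaves t))"
proof -
  have \<tau>: "distinct (vtree_leaves \<tau>)" "X = set (vtree_leaves \<tau>)"
    using assms(1) by (simp_all add: vtree_on_def)
  then have "length (vtree_leaves \<tau>) = card X" by (simp add: distinct_card)
  with assms(2) obtain t where t: "t \<in> subtrees \<tau>"
    "card X \<le> 3 * length (vtree_leaves t)" "3 * length (vtree_leaves t) \<le> 2 * card X"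
    using ex_balanced_subtree[of "card X" \<tau>] by auto
  have "card (set (vtree_leaves t)) = length (vtree_leaves t)"
    using subtrees_distinct_leaves[OF t(1) \<tau>(1)] by (rule distinct_card)
  moreover have "card (X - set (vtree_leaves t)) = card X - card (set (vtree_leaves t))"
    using subtrees_leaves_subset[OF t(1)] \<tau>(2) by (intro card_Diff_subset) auto
  ultimately show thesis using t by (intro that) auto
qed

lemma gate_input_in_gates:
  "is_circuit D \<Longrightarrow> g \<in> gates D \<Longrightarrow> h \<in> set (gate_inputs (gate D g)) \<Longrightarrow> h \<in> gates D"
  by (auto simp: is_circuit_def)

lemma gate_vars_input:
  assumes "g \<in> gates D" "h \<in> set (gate_inputs (gate D g))"
  shows "gate_vars D h \<subseteq> gate_vars D g"
proof -
  have "(h, g) \<in> wires D" using assms by (simp add: wires_def)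
  then show ?thesis unfolding gate_vars_def by (auto intro: rtrancl_into_rtrancl)
qed

lemma gate_sat_cong:
  assumes "is_circuit D" "gate_sat D a g" "g \<in> gates D" "\<And>x. x \<in> gate_vars D g \<Longrightarrow> a x = b x"
  shows "gate_sat D b g"
proof -
  have inputs: "h \<in> gates D \<and> gate_vars D h \<subseteq> gate_vars D g"
    if "g \<in> gates D" "h \<in> set (gate_inputs (gate D g))" for g h
    using that gate_input_in_gates[OF assms(1)] gate_vars_input[of g D h] by simp
  show ?thesis using assms(2-4)
  proof (induction rule: gate_sat.induct)
    case (1 g x v)
    then have "x \<in> gate_vars D g" by (auto simp: gate_vars_def)
    then show ?case using 1 gate_sat.intros(1) by metis
  next
    case (2 g h1 h2)
    then show ?case
      using inputs[of g h1] inputs[of g h2] by (intro gate_sat.intros(2)[OF 2(1)]) auto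
  next
    case (3 g h1 h2)
    then show ?case using inputs[of g h1] by (intro gate_sat.intros(3)[OF 3(1)]) auto
  next
    case (4 g h1 h2)
    then show ?case using inputs[of g h2] by (intro gate_sat.intros(4)[OF 4(1)]) auto
  qed
qed

lemma d_SDNNF_And_cut:
  assumes D: "is_d_SDNNF X D \<tau> lam" and t: "t \<in> subtrees \<tau>"
    and g: "g \<in> gates D" "gate D g = And h1 h2"
  shows "gate_vars D g \<subseteq> set (vtree_leaves t) \<or> gate_vars D h1 \<inter> set (vtree_leaves t) = {} \<or>
    gate_vars D h2 \<inter> set (vtree_leaves t) = {}"
proof -
  have dist: "distinct (vtree_leaves \<tau>)" and lam: "lam g \<in> subtrees \<tau>"
    and vars: "\<And>h. h \<in> gates D \<Longrightarrow> gate_vars D h \<subseteq> set (vtree_leaves (lam h))"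
    and inputs: "h1 \<in> gates D" "h2 \<in> gates D"
    using D g by (auto simp: is_d_SDNNF_def vtree_on_def is_circuit_def)
  obtain t1 t2 where node: "lam g = VNode t1 t2 \<or> lam g = VNode t2 t1"
    and "lam h1 \<in> subtrees t1" "lam h2 \<in> subtrees t2"
    using D g unfolding is_d_SDNNF_def by meson
  then have vars1: "gate_vars D h1 \<subseteq> set (vtree_leaves t1)"
    and vars2: "gate_vars D h2 \<subseteq> set (vtree_leaves t2)"
    using vars inputs subtrees_leaves_subset by blast+
  have disjoint: "set (vtree_leaves t1) \<inter> set (vtree_leaves t2) = {}"
    using node subtrees_distinct_leaves[OF lam dist] by auto
  consider "lam g \<in> subtrees t" | "set (vtree_leaves (lam g)) \<inter> set (vtree_leaves t) = {}"
    | "t \<in> subtrees t1" | "t \<in> subtrees t2"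
    using subtrees_nested_or_disjoint[OF dist lam t] node subtrees_refl[of t] by fastforce
  then show ?thesis
  proof cases
    case 1
    then show ?thesis using vars g(1) subtrees_leaves_subset by blast
  next
    case 2
    then have "set (vtree_leaves t1) \<inter> set (vtree_leaves t) = {}" using node by auto
    then show ?thesis using vars1 by blast
  next
    case 3
    then show ?thesis using vars2 disjoint subtrees_leaves_subset by blast
  next
    case 4
    then show ?thesis using vars1 disjoint subtrees_leaves_subset by blast
  qed
qed

text \<open>The gate \<open>h\<close> is where the path that a satisfying assignment traces towards the vtree node \<open>t\<close>
  stops; everything hanging off that path has no variables below \<open>t\<close>.\<close>

lemma d_SDNNF_exchange_gate:
  assumes D: "is_d_SDNNF X D \<tau> lam" and t: "t \<in> subtrees \<tau>"
    and "gate_sat D a g" "g \<in> gates D"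
  shows "\<exists>h\<in>gates D. gate_sat D a h \<and>
    (\<forall>b. gate_sat D b h \<longrightarrow> gate_sat D (override_on a b (set (vtree_leaves t))) g)"
proof -
  let ?T = "set (vtree_leaves t)"
  have circ: "is_circuit D" using D by (simp add: is_d_SDNNF_def)
  note inputs = gate_input_in_gates[OF circ]
  show ?thesis using assms(3,4)
  proof (induction rule: gate_sat.induct)
    case (1 g x v)
    have "gate_sat D b g \<longleftrightarrow> b x = v" for b
      using 1 by (subst gate_sat.simps) auto
    then show ?case using 1 by (intro bexI[of _ g]) (auto simp: override_on_def)
  next
    case (2 g h1 h2)
    note AndI = gate_sat.intros(2)[OF \<open>gate D g = And h1 h2\<close>]
    have h: "h1 \<in> gates D" "h2 \<in> gates D" using inputs[OF "2.prems"] 2 by auto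
    have outside: "gate_sat D (override_on a b ?T) h"
      if "gate_sat D a h" "h \<in> gates D" "gate_vars D h \<inter> ?T = {}" for b h
      using that by (intro gate_sat_cong[OF circ that(1,2)]) (auto simp: override_on_def)
    consider "gate_vars D g \<subseteq> ?T" | "gate_vars D h1 \<inter> ?T = {}" | "gate_vars D h2 \<inter> ?T = {}"
      using d_SDNNF_And_cut[OF D t] 2 by blast
    then show ?case
    proof cases
      case 1
      have "gate_sat D (override_on a b ?T) g" if "gate_sat D b g" for b
        using 1 "2.prems" by (intro gate_sat_cong[OF circ that]) (auto simp: override_on_def)
      moreover have "gate_sat D a g" using 2 by (intro AndI)
      ultimately show ?thesis using "2.prems" by blast
    qed (use 2 h outside AndI in blast)+
  next
    case (3 g h1 h2)
    then have "h1 \<in> gates D" using inputs by auto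
    then show ?case using 3 gate_sat.intros(3)[OF 3(1)] by blast
  next
    case (4 g h1 h2)
    then have "h2 \<in> gates D" using inputs by auto
    then show ?case using 4 gate_sat.intros(4)[OF 4(1)] by blast
  qed
qed

definition fooling_set :: "(('v \<Rightarrow> bool) \<Rightarrow> bool) \<Rightarrow> 'v set \<Rightarrow> ('v \<Rightarrow> bool) set \<Rightarrow> bool" where
  "fooling_set f T M \<longleftrightarrow> (\<forall>a\<in>M. f a) \<and> (\<forall>a\<in>M. \<forall>b\<in>M. f (override_on a b T) \<longrightarrow> a = b)"

lemma fooling_set_image:
  assumes "\<And>u v. u \<in> V \<Longrightarrow> v \<in> V \<Longrightarrow> f (override_on (\<sigma> u) (\<sigma> v) T) \<longleftrightarrow> u = v"
  shows "fooling_set f T (\<sigma> ` V)" "inj_on \<sigma> V"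
proof -
  have same: "override_on (\<sigma> u) (\<sigma> u) T = \<sigma> u" for u
    by (simp add: override_on_def fun_eq_iff)
  then have "f (\<sigma> u)" if "u \<in> V" for u using assms[OF that that] by simp
  then show "fooling_set f T (\<sigma> ` V)" using assms unfolding fooling_set_def by blast
  show "inj_on \<sigma> V" using assms same by (metis inj_onI)
qed

lemma card_fooling_set_le_gates:
  assumes D: "d_SDNNF_computes D \<tau> lam F" and t: "t \<in> subtrees \<tau>"
    and M: "fooling_set (system_sat F) (set (vtree_leaves t)) M"
  shows "card M \<le> card (gates D)"
proof -
  have SD: "is_d_SDNNF (system_vars F) D \<tau> lam"
    and out: "\<And>a. gate_sat D a (output_gate D) \<longleftrightarrow> system_sat F a"
    using D by (simp_all add: d_SDNNF_computes_def)
  then have gates: "output_gate D \<in> gates D" "finite (gates D)"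
    by (auto simp: is_d_SDNNF_def is_circuit_def)
  have "\<forall>a\<in>M. \<exists>h\<in>gates D. gate_sat D a h \<and>
      (\<forall>b. gate_sat D b h \<longrightarrow> system_sat F (override_on a b (set (vtree_leaves t))))"
    using d_SDNNF_exchange_gate[OF SD t _ gates(1)] M unfolding fooling_set_def out by blast
  then obtain h where h: "h a \<in> gates D" "gate_sat D a (h a)"
      "gate_sat D b (h a) \<Longrightarrow> system_sat F (override_on a b (set (vtree_leaves t)))"
    if "a \<in> M" for a b by metis
  have "inj_on h M"
    using h(2,3) M unfolding fooling_set_def by (metis inj_onI)
  moreover have "h ` M \<subseteq> gates D" using h(1) by blast
  ultimately show ?thesis using gates(2) by (rule card_inj_on_le)
qed


section \<open>Systems of congruences\<close>

definition modular_constraint :: "'v set \<Rightarrow> ('v \<Rightarrow> 'r \<Rightarrow> int) \<Rightarrow> nat \<Rightarrow> 'r \<Rightarrow> 'v constraint" where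
  "modular_constraint X w p r =
     \<lparr>cvar = X, cfun = \<lambda>a. int p dvd (\<Sum>x\<in>{x \<in> X. a x}. w x r)\<rparr>"

definition modular_system ::
    "'v set \<Rightarrow> ('v \<Rightarrow> 'r \<Rightarrow> int) \<Rightarrow> nat \<Rightarrow> 'r set \<Rightarrow> 'v constraint set" where
  "modular_system X w p R = modular_constraint X w p ` R"

lemma is_system_modular_system:
  assumes "finite X" "finite R"
  shows "is_system (modular_system X w p R)"
proof -
  have "cfun (modular_constraint X w p r) a = cfun (modular_constraint X w p r) b"
    if "\<forall>x\<in>X. a x = b x" for r a b
  proof -
    have "{x \<in> X. a x} = {x \<in> X. b x}" using that by blast
    then show ?thesis by (simp add: modular_constraint_def)
  qed
  moreover have "cvar (modular_constraint X w p r) = X" for r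
    by (simp add: modular_constraint_def)
  ultimately show ?thesis
    using assms unfolding is_system_def is_constraint_def modular_system_def by auto
qed

lemma system_vars_modular_system: "R \<noteq> {} \<Longrightarrow> system_vars (modular_system X w p R) = X"
  by (auto simp: system_vars_def modular_system_def modular_constraint_def)

lemma system_sat_modular_system:
  "system_sat (modular_system X w p R) a \<longleftrightarrow> (\<forall>r\<in>R. int p dvd (\<Sum>x\<in>{x \<in> X. a x}. w x r))"
  by (simp add: system_sat_def modular_system_def modular_constraint_def)

lemma modular_system_satisfiable: "\<exists>a. system_sat (modular_system X w p R) a"
  by (rule exI[of _ "\<lambda>_. False"]) (simp add: system_sat_modular_system)

lemma slim_modular_constraint:
  assumes "finite X" "p > 0"
  shows "slim_for_OBDDs p (modular_constraint X w p r)"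
proof -
  let ?wt = "\<lambda>x b. if b then w x r else 0"
  let ?\<delta> = "\<lambda>x b s. (s + ?wt x b) mod int p"
  interpret variable_automaton "{0..<int p}" ?\<delta> 0 "\<lambda>s. s = 0"
    using \<open>p > 0\<close> by unfold_locales auto
  have fold_sum: "fold (\<lambda>x. ?\<delta> x (a x)) \<pi> s mod int p = (s + (\<Sum>x\<in>set \<pi>. ?wt x (a x))) mod int p"
    if "distinct \<pi>" for \<pi> a s
    using that by (induction \<pi> arbitrary: s) (simp_all add: mod_add_left_eq add.assoc)
  have fold_less: "fold (\<lambda>x. ?\<delta> x (a x)) \<pi> 0 \<in> {0..<int p}" for \<pi> a
    using \<open>p > 0\<close> by (induction \<pi> rule: rev_induct) auto
  have "slim_for_OBDDs (card {0..<int p}) (modular_constraint X w p r)"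
  proof (rule slim_for_OBDDs_card_states)
    fix \<pi> a assume \<pi>: "distinct \<pi>" "set \<pi> = cvar (modular_constraint X w p r)"
    have "cfun (modular_constraint X w p r) a \<longleftrightarrow> (\<Sum>x\<in>set \<pi>. ?wt x (a x)) mod int p = 0"
      using \<open>finite X\<close> \<pi>(2) by (simp add: modular_constraint_def sum.inter_filter dvd_eq_mod_eq_0)
    also have "\<dots> \<longleftrightarrow> fold (\<lambda>x. ?\<delta> x (a x)) \<pi> 0 mod int p = 0"
      unfolding fold_sum[OF \<pi>(1)] by simp
    also have "\<dots> \<longleftrightarrow> fold (\<lambda>x. ?\<delta> x (a x)) \<pi> 0 = 0"
      using fold_less[of a \<pi>] by simp
    finally show "cfun (modular_constraint X w p r) a \<longleftrightarrow> fold (\<lambda>x. ?\<delta> x (a x)) \<pi> 0 = 0" .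
  qed
  then show ?thesis by simp
qed

lemma slim_modular_system:
  "finite X \<Longrightarrow> p > 0 \<Longrightarrow> c \<in> modular_system X w p R \<Longrightarrow> slim_for_OBDDs p c"
  by (auto simp: modular_system_def slim_modular_constraint)

lemma incidence_treewidth_modular_system:
  assumes "finite X" "finite R"
  shows "incidence_treewidth (modular_system X w p R) \<le> card R"
proof -
  have "incidence_treewidth (modular_system X w p R) \<le> card (modular_system X w p R)"
    using assms by (intro incidence_treewidth_le_card is_system_modular_system)
  also have "\<dots> \<le> card R" unfolding modular_system_def using assms(2) by (rule card_image_le)
  finally show ?thesis .
qed


section \<open>Subset sums modulo \<open>p\<close>\<close>

definition frequent :: "nat \<Rightarrow> ('v \<Rightarrow> 'e) \<Rightarrow> 'v set \<Rightarrow> 'e set" where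
  "frequent p f Y = {e. p \<le> card {x \<in> Y. f x = e}}"

lemma finite_frequent:
  assumes "finite Y" "p > 0"
  shows "finite (frequent p f Y)"
proof (rule finite_subset)
  show "frequent p f Y \<subseteq> f ` Y"
  proof
    fix e assume "e \<in> frequent p f Y"
    then have "card {x \<in> Y. f x = e} \<noteq> 0" using \<open>p > 0\<close> by (simp add: frequent_def)
    then have "{x \<in> Y. f x = e} \<noteq> {}" by (metis card.empty)
    then show "e \<in> f ` Y" by blast
  qed
qed (simp add: assms)

lemma frequent_comp:
  assumes "finite Y" "e \<in> frequent p f Y"
  shows "g e \<in> frequent p (\<lambda>x. g (f x)) Y"
proof -
  have "card {x \<in> Y. f x = e} \<le> card {x \<in> Y. g (f x) = g e}"
    using assms(1) by (intro card_mono) auto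
  then show ?thesis using assms(2) by (simp add: frequent_def)
qed

lemma frequent_subset_Un_Diff:
  assumes "Y \<subseteq> X"
  shows "frequent (2 * p) f X \<subseteq> frequent p f Y \<union> frequent p f (X - Y)"
proof
  fix e assume "e \<in> frequent (2 * p) f X"
  then have "2 * p \<le> card {x \<in> X. f x = e}" by (simp add: frequent_def)
  also have "{x \<in> X. f x = e} = {x \<in> Y. f x = e} \<union> {x \<in> X - Y. f x = e}" using assms by blast
  also have "card \<dots> \<le> card {x \<in> Y. f x = e} + card {x \<in> X - Y. f x = e}" by (rule card_Un_le)
  finally show "e \<in> frequent p f Y \<union> frequent p f (X - Y)" by (auto simp: frequent_def)
qed

definition int_scale :: "int \<Rightarrow> ('r \<Rightarrow> int) \<Rightarrow> 'r \<Rightarrow> int" where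
  "int_scale c u = (\<lambda>r. c * u r)"

interpretation int_vectors: module int_scale
  by unfold_locales (simp_all add: int_scale_def fun_eq_iff algebra_simps)

lemma sum_fun_apply: "(\<Sum>x\<in>A. f x) r = (\<Sum>x\<in>A. f x r)"
  by (induction A rule: infinite_finite_induct) auto

lemma subset_sum_span_frequent:
  fixes w :: "'v \<Rightarrow> 'r \<Rightarrow> int"
  assumes "finite Y" "p > 0" "u \<in> int_vectors.span (frequent p w Y)"
  shows "\<exists>S\<subseteq>Y. \<forall>r. [(\<Sum>x\<in>S. w x r) = u r] (mod int p)"
proof -
  let ?A = "frequent p w Y"
  have finA: "finite ?A" using assms(1,2) by (rule finite_frequent)
  obtain c where u: "u = (\<Sum>v\<in>?A. int_scale (c v) v)"
    using assms(3) int_vectors.span_finite[OF finA] by auto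
  have "\<exists>T\<subseteq>{x \<in> Y. w x = v}. card T = nat (c v mod int p)" if "v \<in> ?A" for v
  proof -
    have "nat (c v mod int p) \<le> p" using \<open>p > 0\<close> by (simp add: nat_le_iff less_imp_le)
    then have "nat (c v mod int p) \<le> card {x \<in> Y. w x = v}"
      using that by (simp add: frequent_def)
    then show ?thesis by (rule obtain_subset_with_card_n) blast
  qed
  then obtain T where T: "T v \<subseteq> {x \<in> Y. w x = v}" "card (T v) = nat (c v mod int p)"
    if "v \<in> ?A" for v by metis
  have "[(\<Sum>x\<in>(\<Union>v\<in>?A. T v). w x r) = u r] (mod int p)" for r
  proof -
    have "(\<Sum>x\<in>(\<Union>v\<in>?A. T v). w x r) = (\<Sum>v\<in>?A. \<Sum>x\<in>T v. w x r)"
    proof (intro sum.UNION_disjoint ballI impI)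
      show "finite (T v)" if "v \<in> ?A" for v
        using T(1)[OF that] assms(1) by (auto intro: finite_subset)
      show "T v \<inter> T v' = {}" if "v \<in> ?A" "v' \<in> ?A" "v \<noteq> v'" for v v'
        using T(1)[OF that(1)] T(1)[OF that(2)] that(3) by blast
    qed (rule finA)
    also have "\<dots> = (\<Sum>v\<in>?A. (c v mod int p) * v r)"
    proof (rule sum.cong[OF refl])
      fix v assume "v \<in> ?A"
      then have "(\<Sum>x\<in>T v. w x r) = (\<Sum>x\<in>T v. v r)" using T(1) by (intro sum.cong) auto
      then show "(\<Sum>x\<in>T v. w x r) = (c v mod int p) * v r"
        using T(2)[OF \<open>v \<in> ?A\<close>] \<open>p > 0\<close> by simp
    qed
    also have "[\<dots> = (\<Sum>v\<in>?A. c v * v r)] (mod int p)"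
      by (intro cong_sum cong_scalar_right) simp
    finally show ?thesis by (simp add: u sum_fun_apply int_scale_def)
  qed
  then show ?thesis using T(1) by (intro exI[of _ "\<Union>v\<in>?A. T v"]) auto
qed

lemma obtain_subset_sums_span_frequent:
  fixes w :: "'v \<Rightarrow> 'r \<Rightarrow> int"
  assumes "finite Y" "p > 0"
  obtains S where "\<And>u. u \<in> int_vectors.span (frequent p w Y) \<Longrightarrow> S u \<subseteq> Y"
    "\<And>u r. u \<in> int_vectors.span (frequent p w Y) \<Longrightarrow> [(\<Sum>x\<in>S u. w x r) = u r] (mod int p)"
proof -
  have "\<forall>u\<in>int_vectors.span (frequent p w Y).
      \<exists>S. S \<subseteq> Y \<and> (\<forall>r. [(\<Sum>x\<in>S. w x r) = u r] (mod int p))"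
    using subset_sum_span_frequent[OF assms] by blast
  from bchoice[OF this] show thesis using that by blast
qed

lemma system_sat_modular_system_Un:
  assumes "finite X" "Y \<subseteq> X" "S \<subseteq> Y" "U \<subseteq> X - Y"
  shows "system_sat (modular_system X w p R) (\<lambda>x. x \<in> S \<union> U) \<longleftrightarrow>
    (\<forall>r\<in>R. int p dvd (\<Sum>x\<in>S. w x r) + (\<Sum>x\<in>U. w x r))"
proof -
  have "{x \<in> X. x \<in> S \<union> U} = S \<union> U" using assms by blast
  moreover have "sum f (S \<union> U) = sum f S + sum f U" for f :: "'a \<Rightarrow> int"
    using assms by (intro sum.union_disjoint) (auto intro: finite_subset)
  ultimately show ?thesis by (simp only: system_sat_modular_system)
qed

lemma obtain_modular_fooling_set:
  fixes w :: "'v \<Rightarrow> 'r \<Rightarrow> int"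
  assumes X: "finite X" "Y \<subseteq> X" and "p > 0"
    and span_Y: "V \<subseteq> int_vectors.span (frequent p w Y)"
    and span_compl: "V \<subseteq> int_vectors.span (frequent p w (X - Y))"
    and incongruent: "\<And>u v. u \<in> V \<Longrightarrow> v \<in> V \<Longrightarrow> \<forall>r\<in>R. [u r = v r] (mod int p) \<Longrightarrow> u = v"
  obtains M where "fooling_set (system_sat (modular_system X w p R)) Y M" "card M = card V"
proof -
  let ?sat = "system_sat (modular_system X w p R)"
  have fin: "finite Y" "finite (X - Y)" using X by (auto intro: finite_subset)
  have span: "u \<in> int_vectors.span (frequent p w Y)" "- u \<in> int_vectors.span (frequent p w (X - Y))"
    if "u \<in> V" for u using that span_Y span_compl by (auto intro: int_vectors.span_neg)
  obtain S where "\<And>u. u \<in> int_vectors.span (frequent p w Y) \<Longrightarrow> S u \<subseteq> Y"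
    "\<And>u r. u \<in> int_vectors.span (frequent p w Y) \<Longrightarrow> [(\<Sum>x\<in>S u. w x r) = u r] (mod int p)"
    using obtain_subset_sums_span_frequent[OF fin(1) \<open>p > 0\<close>, of w] by blast
  note S = this[OF span(1)]
  obtain U where "\<And>u. u \<in> int_vectors.span (frequent p w (X - Y)) \<Longrightarrow> U u \<subseteq> X - Y"
    "\<And>u r. u \<in> int_vectors.span (frequent p w (X - Y)) \<Longrightarrow> [(\<Sum>x\<in>U u. w x r) = u r] (mod int p)"
    using obtain_subset_sums_span_frequent[OF fin(2) \<open>p > 0\<close>, of w] by blast
  note U = this[OF span(2)]
  define \<sigma> where "\<sigma> u = (\<lambda>x. x \<in> S u \<union> U (- u))" for u
  have "?sat (override_on (\<sigma> u) (\<sigma> v) Y) \<longleftrightarrow> (\<forall>r\<in>R. [u r = v r] (mod int p))"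
    if u: "u \<in> V" and v: "v \<in> V" for u v
  proof -
    have "override_on (\<sigma> u) (\<sigma> v) Y = (\<lambda>x. x \<in> S v \<union> U (- u))"
      using S(1)[OF u] S(1)[OF v] U(1)[OF u] U(1)[OF v]
      by (auto simp: \<sigma>_def override_on_def fun_eq_iff)
    moreover have "int p dvd (\<Sum>x\<in>S v. w x r) + (\<Sum>x\<in>U (- u). w x r) \<longleftrightarrow> int p dvd v r - u r" for r
      using cong_add[OF S(2)[OF v] U(2)[OF u], of r r] by (simp add: cong_dvd_iff)
    ultimately show ?thesis
      by (simp only: system_sat_modular_system_Un[OF X S(1)[OF v] U(1)[OF u]] cong_iff_dvd_diff
          dvd_diff_commute)
  qed
  then have "?sat (override_on (\<sigma> u) (\<sigma> v) Y) \<longleftrightarrow> u = v" if "u \<in> V" "v \<in> V" for u v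
    using that incongruent[of u v] by auto
  note fooling = fooling_set_image[of V ?sat \<sigma> Y, OF this]
  show thesis using fooling(1) card_image[OF fooling(2)] by (rule that)
qed


section \<open>Arcs and circulations\<close>

definition arc_vector :: "'q \<times> 'q \<Rightarrow> 'q \<Rightarrow> int" where
  "arc_vector e r = of_bool (r = fst e) - of_bool (r = snd e)"

definition circulation_system ::
    "('v \<Rightarrow> 'q \<times> 'q) \<Rightarrow> 'v set \<Rightarrow> nat \<Rightarrow> 'q set \<Rightarrow> 'v constraint set" where
  "circulation_system arc X p Q = modular_system X (\<lambda>x. arc_vector (arc x)) p Q"

definition arc_span :: "('q \<Rightarrow> int) set \<Rightarrow> ('q \<times> 'q) set" where
  "arc_span A = {e. arc_vector e \<in> int_vectors.span A}"

lemma sym_arc_span: "sym (arc_span A)"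
proof (rule symI)
  fix i j assume "(i, j) \<in> arc_span A"
  then have "- arc_vector (i, j) \<in> int_vectors.span A"
    by (simp add: arc_span_def int_vectors.span_neg)
  also have "- arc_vector (i, j) = arc_vector (j, i)" by (simp add: arc_vector_def fun_eq_iff)
  finally show "(j, i) \<in> arc_span A" by (simp add: arc_span_def)
qed

lemma trans_arc_span: "trans (arc_span A)"
proof (rule transI)
  fix i j l assume "(i, j) \<in> arc_span A" "(j, l) \<in> arc_span A"
  then have "arc_vector (i, j) + arc_vector (j, l) \<in> int_vectors.span A"
    by (simp add: arc_span_def int_vectors.span_add)
  also have "arc_vector (i, j) + arc_vector (j, l) = arc_vector (i, l)"
    by (simp add: arc_vector_def fun_eq_iff)
  finally show "(i, l) \<in> arc_span A" by (simp add: arc_span_def)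
qed

lemma frequent_subset_arc_span:
  assumes "finite Y"
  shows "frequent p arc Y \<subseteq> arc_span (frequent p (\<lambda>x. arc_vector (arc x)) Y)"
  using assms by (auto simp: arc_span_def intro: int_vectors.span_base frequent_comp)

text \<open>For equivalence relations this says that a graph or its complement is connected.\<close>

lemma sym_trans_cover:
  assumes R: "sym R" "trans R" and S: "sym S" "trans S" and cover: "Q \<times> Q \<subseteq> R \<union> S"
  shows "Q \<times> Q \<subseteq> R \<or> Q \<times> Q \<subseteq> S"
proof (rule disjCI)
  assume "\<not> Q \<times> Q \<subseteq> S"
  then obtain u v where uv: "u \<in> Q" "v \<in> Q" "(u, v) \<notin> S" by blast
  have u_R: "(u, i) \<in> R" if "i \<in> Q" for i
  proof (cases "(u, i) \<in> S")
    case True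
    then have "(i, v) \<notin> S" using uv(3) S(2) by (meson transD)
    then have "(u, v) \<in> R" "(i, v) \<in> R" using cover that uv by blast+
    then show ?thesis using R by (meson symD transD)
  qed (use cover uv that in blast)
  show "Q \<times> Q \<subseteq> R"
  proof clarify
    fix i j assume "i \<in> Q" "j \<in> Q"
    then show "(i, j) \<in> R" using u_R R by (meson symD transD)
  qed
qed

definition star_flow :: "'q \<Rightarrow> 'q set \<Rightarrow> ('q \<Rightarrow> nat) \<Rightarrow> 'q \<Rightarrow> int" where
  "star_flow i J f = (\<Sum>j\<in>J. int_scale (int (f j)) (arc_vector (i, j)))"

lemma star_flow_leaf:
  assumes "finite J" "i \<notin> J" "r \<in> J"
  shows "star_flow i J f r = - int (f r)"
proof -
  have "star_flow i J f r = (\<Sum>j\<in>J. if j = r then - int (f j) else 0)"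
    unfolding star_flow_def sum_fun_apply int_scale_def
    using assms by (intro sum.cong) (auto simp: arc_vector_def)
  then show ?thesis using assms by simp
qed

lemma star_flow_cong_imp_eq:
  assumes J: "finite J" "i \<notin> J" and f: "f \<in> J \<rightarrow>\<^sub>E {..<p}" and g: "g \<in> J \<rightarrow>\<^sub>E {..<p}"
    and cong: "\<And>r. r \<in> J \<Longrightarrow> [star_flow i J f r = star_flow i J g r] (mod int p)"
  shows "f = g"
proof (rule PiE_ext[OF f g])
  fix r assume "r \<in> J"
  then have "[int (f r) = int (g r)] (mod int p)"
    using cong[of r] by (simp add: star_flow_leaf[OF J] cong_minus_minus_iff)
  moreover have "f r < p" "g r < p" using f g \<open>r \<in> J\<close> by auto
  ultimately show "f r = g r" by (simp add: cong_int_iff cong_less_modulus_unique_nat)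
qed

lemma card_star_flows:
  assumes "finite J" "i \<notin> J"
  shows "card (star_flow i J ` (J \<rightarrow>\<^sub>E {..<p})) = p ^ card J"
proof -
  have "inj_on (star_flow i J) (J \<rightarrow>\<^sub>E {..<p})"
    using star_flow_cong_imp_eq[OF assms] by (intro inj_onI) simp
  then show ?thesis using assms(1) by (simp add: card_image card_PiE)
qed

lemma star_flow_in_span: "Pair i ` J \<subseteq> arc_span A \<Longrightarrow> star_flow i J f \<in> int_vectors.span A"
  unfolding star_flow_def arc_span_def
  by (intro int_vectors.span_sum int_vectors.span_scale) blast


section \<open>Frequent arcs\<close>

definition uniform_labelling :: "('v \<Rightarrow> 'e) \<Rightarrow> 'v set \<Rightarrow> 'e set \<Rightarrow> nat \<Rightarrow> bool" where
  "uniform_labelling f X E m \<longleftrightarrow>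
     finite X \<and> f ` X \<subseteq> E \<and> (\<forall>e\<in>E. card {x \<in> X. f x = e} = m)"

lemma card_eq_sum_fibres:
  assumes "finite Y" "finite E" "f ` Y \<subseteq> E"
  shows "card Y = (\<Sum>e\<in>E. card {x \<in> Y. f x = e})"
  using sum.group[OF assms, of "\<lambda>_. 1 :: nat"] by simp

lemma card_uniform_labelling:
  assumes "uniform_labelling f X E m" "finite E"
  shows "card X = card E * m"
  using assms card_eq_sum_fibres[of X E f] by (simp add: uniform_labelling_def)

lemma ex_uniform_labelling:
  fixes E :: "'e::countable set"
  assumes "finite E"
  shows "\<exists>(f :: nat \<Rightarrow> 'e) X. uniform_labelling f X E m"
proof -
  define f :: "nat \<Rightarrow> 'e" where "f x = fst (from_nat x :: 'e \<times> nat)" for x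
  define X where "X = (to_nat :: 'e \<times> nat \<Rightarrow> nat) ` (E \<times> {..<m})"
  have "card {x \<in> X. f x = e} = m" if "e \<in> E" for e
  proof -
    have "{x \<in> X. f x = e} = (to_nat :: 'e \<times> nat \<Rightarrow> nat) ` ({e} \<times> {..<m})"
      using that by (auto simp: X_def f_def)
    then show ?thesis by (simp add: card_image)
  qed
  moreover have "finite X" "f ` X \<subseteq> E" using assms by (auto simp: X_def f_def)
  ultimately show ?thesis unfolding uniform_labelling_def by blast
qed

lemma card_le_frequent:
  assumes Y: "finite Y" "finite E" "f ` Y \<subseteq> E" and le: "\<And>e. e \<in> E \<Longrightarrow> card {x \<in> Y. f x = e} \<le> m"
  shows "card Y \<le> card E * p + card (E \<inter> frequent p f Y) * m"
proof -
  have "card Y = (\<Sum>e\<in>E. card {x \<in> Y. f x = e})" using Y by (rule card_eq_sum_fibres)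
  also have "\<dots> \<le> (\<Sum>e\<in>E. p + (if e \<in> frequent p f Y then m else 0))"
  proof (rule sum_mono)
    show "card {x \<in> Y. f x = e} \<le> p + (if e \<in> frequent p f Y then m else 0)" if "e \<in> E" for e
      using le[OF that] by (simp add: frequent_def)
  qed
  also have "\<dots> = card E * p + card (E \<inter> frequent p f Y) * m"
    using Y(2) by (simp add: sum.distrib flip: sum.inter_restrict)
  finally show ?thesis .
qed

lemma obtain_out_star:
  assumes Q: "finite Q" "A \<subseteq> Q \<times> Q" and large: "card Q * k < card A"
  obtains i J where "i \<in> Q" "J \<subseteq> Q" "i \<notin> J" "card J = k" "Pair i ` J \<subseteq> A"
proof -
  have "\<exists>i\<in>Q. k < card (A `` {i})"
  proof (rule ccontr)
    assume "\<not> ?thesis"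
    then have "(\<Sum>i\<in>Q. card (A `` {i})) \<le> card Q * k"
      using sum_bounded_above[of Q "\<lambda>i. card (A `` {i})" k] by (simp add: not_less)
    moreover have "A = (SIGMA i:Q. A `` {i})" using Q(2) by auto
    then have "card A = (\<Sum>i\<in>Q. card (A `` {i}))"
      using Q by (metis card_SigmaI finite_Image finite_SigmaI finite_subset)
    ultimately show False using large by simp
  qed
  then obtain i where i: "i \<in> Q" "k < card (A `` {i})" by blast
  then have "k \<le> card (A `` {i} - {i})" by (auto simp: card_Diff_singleton_if)
  then obtain J where "J \<subseteq> A `` {i} - {i}" "card J = k" by (rule obtain_subset_with_card_n)
  then show thesis using Q(2) i(1) by (intro that) auto
qed

lemma obtain_frequent_star:
  assumes arc: "uniform_labelling arc X (Q \<times> Q) (6 * p)" and Q: "finite Q" "6 * k < card Q"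
    and Y: "Y \<subseteq> X" "card X \<le> 3 * card Y" and "p > 0"
  obtains i J where "i \<in> Q" "J \<subseteq> Q" "i \<notin> J" "card J = k" "Pair i ` J \<subseteq> frequent p arc Y"
proof -
  define A where "A = (Q \<times> Q) \<inter> frequent p arc Y"
  have finX: "finite X" and copies: "\<And>e. e \<in> Q \<times> Q \<Longrightarrow> card {x \<in> X. arc x = e} = 6 * p"
    using arc by (auto simp: uniform_labelling_def)
  have "card {x \<in> Y. arc x = e} \<le> 6 * p" if "e \<in> Q \<times> Q" for e
    unfolding copies[OF that, symmetric] using finX Y(1) by (intro card_mono) auto
  moreover have "finite Y" "arc ` Y \<subseteq> Q \<times> Q"
    using arc Y(1) by (auto simp: uniform_labelling_def intro: finite_subset)
  ultimately have "card Y \<le> card (Q \<times> Q) * p + card A * (6 * p)"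
    unfolding A_def using Q(1) by (intro card_le_frequent) auto
  then have "card Y \<le> card Q * card Q * p + 6 * (card A * p)"
    by (simp add: card_cartesian_product)
  moreover have "6 * (card Q * card Q * p) \<le> 3 * card Y"
    using card_uniform_labelling[OF arc] Q(1) Y(2) by (simp add: card_cartesian_product)
  ultimately have "card Q * card Q * p \<le> 6 * card A * p" by linarith
  then have "card Q * card Q \<le> 6 * card A" using \<open>p > 0\<close> by simp
  moreover have "card Q * (6 * k) < card Q * card Q" using Q(2) by simp
  ultimately have "card Q * k < card A" by linarith
  then show thesis
    by (rule obtain_out_star[rotated 2]) (use Q(1) that A_def in auto)
qed

lemma obtain_spanned_star:
  assumes arc: "uniform_labelling arc X (Q \<times> Q) (6 * p)" and Q: "finite Q" "6 * k < card Q"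
    and "Y \<subseteq> X" and balanced: "card X \<le> 3 * card Y" "card X \<le> 3 * card (X - Y)" and "p > 0"
  obtains i J where "J \<subseteq> Q" "i \<notin> J" "card J = k"
    "Pair i ` J \<subseteq> arc_span (frequent p (\<lambda>x. arc_vector (arc x)) Y)"
    "Pair i ` J \<subseteq> arc_span (frequent p (\<lambda>x. arc_vector (arc x)) (X - Y))"
proof -
  let ?span = "\<lambda>Z. arc_span (frequent p (\<lambda>x. arc_vector (arc x)) Z)"
  have frequent_span: "frequent p arc Z \<subseteq> ?span Z" if "Z \<subseteq> X" for Z
    using arc that
    by (intro frequent_subset_arc_span) (auto simp: uniform_labelling_def intro: finite_subset)
  have star: "\<exists>i\<in>Q. \<exists>J\<subseteq>Q. i \<notin> J \<and> card J = k \<and> Pair i ` J \<subseteq> ?span Z"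
    if Z: "Z \<subseteq> X" "card X \<le> 3 * card Z" for Z
    using obtain_frequent_star[OF arc Q Z \<open>p > 0\<close>] frequent_span[OF Z(1)] by (metis order_trans)
  have "Q \<times> Q \<subseteq> frequent (2 * p) arc X"
    using arc by (auto simp: uniform_labelling_def frequent_def)
  also have "\<dots> \<subseteq> frequent p arc Y \<union> frequent p arc (X - Y)"
    using \<open>Y \<subseteq> X\<close> by (rule frequent_subset_Un_Diff)
  also have "\<dots> \<subseteq> ?span Y \<union> ?span (X - Y)"
    using \<open>Y \<subseteq> X\<close> by (intro Un_mono frequent_span) auto
  finally have "Q \<times> Q \<subseteq> ?span Y \<or> Q \<times> Q \<subseteq> ?span (X - Y)"
    by (intro sym_trans_cover sym_arc_span trans_arc_span)
  then show thesis
  proof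
    assume full: "Q \<times> Q \<subseteq> ?span Y"
    obtain i J where "i \<in> Q" "J \<subseteq> Q" "i \<notin> J" "card J = k" "Pair i ` J \<subseteq> ?span (X - Y)"
      using star[of "X - Y"] balanced(2) by blast
    then show thesis using full by (intro that[of J i]) auto
  next
    assume full: "Q \<times> Q \<subseteq> ?span (X - Y)"
    obtain i J where "i \<in> Q" "J \<subseteq> Q" "i \<notin> J" "card J = k" "Pair i ` J \<subseteq> ?span Y"
      using star[OF \<open>Y \<subseteq> X\<close> balanced(1)] by blast
    then show thesis using full by (intro that[of J i]) auto
  qed
qed


section \<open>Circuits for circulations\<close>

lemma power_le_circulation_circuit_size:
  assumes arc: "uniform_labelling arc X (Q \<times> Q) (6 * p)" and Q: "finite Q" "6 * k < card Q"
    and "p > 0" and D: "d_SDNNF_computes D \<tau> lam (circulation_system arc X p Q)"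
  shows "p ^ k \<le> circuit_size D"
proof -
  let ?w = "\<lambda>x. arc_vector (arc x)"
  have finX: "finite X" using arc by (simp add: uniform_labelling_def)
  have "Q \<noteq> {}" using Q(2) by auto
  then have \<tau>: "vtree_on X \<tau>"
    using D by (simp add: d_SDNNF_computes_def is_d_SDNNF_def circulation_system_def
        system_vars_modular_system)
  have "card Q * card Q * p > 0" using Q \<open>p > 0\<close> by simp
  then have "card X \<ge> 2"
    using card_uniform_labelling[OF arc] Q(1) by (simp add: card_cartesian_product)
  with \<tau> obtain t where t: "t \<in> subtrees \<tau>" "card X \<le> 3 * card (set (vtree_leaves t))"
    "card X \<le> 3 * card (X - set (vtree_leaves t))" by (rule obtain_balanced_cut)
  define Y where "Y = set (vtree_leaves t)"
  have YX: "Y \<subseteq> X" using \<tau> subtrees_leaves_subset[OF t(1)] by (simp add: Y_def vtree_on_def)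
  obtain i J where J: "J \<subseteq> Q" "i \<notin> J" "card J = k"
    and star: "Pair i ` J \<subseteq> arc_span (frequent p ?w Y)"
      "Pair i ` J \<subseteq> arc_span (frequent p ?w (X - Y))"
    by (rule obtain_spanned_star[OF arc Q YX t(2,3)[folded Y_def] \<open>p > 0\<close>])
  have finJ: "finite J" using J(1) Q(1) by (rule finite_subset)
  let ?V = "star_flow i J ` (J \<rightarrow>\<^sub>E {..<p})"
  obtain M where M: "fooling_set (system_sat (modular_system X ?w p Q)) Y M" "card M = card ?V"
  proof (rule obtain_modular_fooling_set[OF finX YX \<open>p > 0\<close>, of ?V ?w Q])
    show "?V \<subseteq> int_vectors.span (frequent p ?w Y)" "?V \<subseteq> int_vectors.span (frequent p ?w (X - Y))"
      using star by (auto intro: star_flow_in_span)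
    fix u v assume "u \<in> ?V" "v \<in> ?V" and cong: "\<forall>r\<in>Q. [u r = v r] (mod int p)"
    then obtain f g where fg: "f \<in> J \<rightarrow>\<^sub>E {..<p}" "g \<in> J \<rightarrow>\<^sub>E {..<p}"
      and uv: "u = star_flow i J f" "v = star_flow i J g" by blast
    have "f = g" using cong J(1) uv by (intro star_flow_cong_imp_eq[OF finJ J(2) fg]) auto
    then show "u = v" using uv by simp
  qed
  have "p ^ k = card M" using M(2) card_star_flows[OF finJ J(2)] J(3) by simp
  also have "\<dots> \<le> card (gates D)"
    using D t(1) M(1) unfolding Y_def circulation_system_def by (rule card_fooling_set_le_gates)
  also have "\<dots> \<le> circuit_size D" by (simp add: circuit_size_def)
  finally show ?thesis .
qed

lemma powr_half_le_power:
  fixes x y :: real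
  assumes "0 \<le> x" "x \<le> y\<^sup>2" "0 < y"
  shows "x powr (1 / 2 * real k) \<le> y ^ k"
proof -
  have "x powr (1 / 2 * real k) \<le> (y\<^sup>2) powr (1 / 2 * real k)"
    using assms by (intro powr_mono2) auto
  also have "\<dots> = (y powr 2) powr (1 / 2 * real k)" using assms(3) by simp
  also have "\<dots> = y ^ k" unfolding powr_powr using assms(3) by (simp add: powr_realpow)
  finally show ?thesis .
qed

lemma powr_le_circulation_circuit_size:
  assumes arc: "uniform_labelling arc X (Q \<times> Q) (6 * p)" and Q: "finite Q" "card Q = 7 * k"
    and "k > 0" "294 * k \<le> p" and D: "d_SDNNF_computes D \<tau> lam (circulation_system arc X p Q)"
  shows "(real (card X) / real k) powr (1 / 2 * real k) \<le> real (circuit_size D)"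
proof -
  have "p > 0" using \<open>k > 0\<close> \<open>294 * k \<le> p\<close> by simp
  have "card X = 294 * k * k * p"
    using card_uniform_labelling[OF arc] Q by (simp add: card_cartesian_product)
  then have "real (card X) / real k = real (294 * k) * real p" using \<open>k > 0\<close> by simp
  also have "\<dots> \<le> (real p)\<^sup>2"
    unfolding power2_eq_square using \<open>294 * k \<le> p\<close> by (intro mult_right_mono) auto
  finally have "(real (card X) / real k) powr (1 / 2 * real k) \<le> real p ^ k"
    using \<open>p > 0\<close> by (intro powr_half_le_power) auto
  also have "\<dots> \<le> real (circuit_size D)"
    using power_le_circulation_circuit_size[OF arc Q(1) _ \<open>p > 0\<close> D, of k] Q(2) \<open>k > 0\<close>
    by (simp flip: of_nat_power)
  finally show ?thesis .
qed

theorem theorem5: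
  "\<exists>(A::nat) (B::nat) (\<epsilon>::real). \<epsilon> > 0 \<and>
     (\<forall>k::nat. k \<ge> 1 \<longrightarrow> (\<forall>N::nat. \<exists>n\<ge>N. \<exists>F :: nat constraint set.
        is_system F \<and> card (system_vars F) = n \<and> (\<exists>a. system_sat F a) \<and>
        incidence_treewidth F \<le> A * k \<and>
        (\<forall>(D :: (nat, nat) circuit) \<tau> lam. d_SDNNF_computes D \<tau> lam F \<longrightarrow>
           real (circuit_size D) \<ge> (real n / real k) powr (\<epsilon> * real k)) \<and>
        (\<forall>c\<in>F. slim_for_OBDDs (B * n * k) c)))" (is "\<exists>A B \<epsilon>. _ \<and> (\<forall>k. _ \<longrightarrow> (\<forall>N. ?P A B \<epsilon> k N))")
proof (rule exI[of _ 7], rule exI[of _ 1], rule exI[of _ "1/2"], intro conjI allI impI)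
  fix k N :: nat assume k: "k \<ge> 1"
  define p where "p = N + 294 * k"
  let ?Q = "{..<7 * k}"
  obtain arc X where arc: "uniform_labelling arc (X :: nat set) (?Q \<times> ?Q) (6 * p)"
    using ex_uniform_labelling[of "?Q \<times> ?Q"] by blast
  then have X: "finite X" "card X = 294 * k * k * p"
    using card_uniform_labelling[OF arc] by (simp_all add: uniform_labelling_def)
  then have p: "p > 0" "N \<le> p" "p \<le> card X" "p \<le> card X * k" using k by (simp_all add: p_def)
  let ?F = "circulation_system arc X p ?Q"
  show "?P 7 1 (1/2) k N"
  proof (intro exI[of _ "card X"] exI[of _ ?F] conjI allI impI ballI)
    show "N \<le> card X" using p(2,3) by (rule order_trans)
    show "card (system_vars ?F) = card X"
      using k by (simp add: circulation_system_def system_vars_modular_system lessThan_empty_iff)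
    show "is_system ?F" "incidence_treewidth ?F \<le> 7 * k" "\<exists>a. system_sat ?F a"
      using X(1) incidence_treewidth_modular_system[OF X(1), of ?Q]
      by (simp_all add: circulation_system_def is_system_modular_system modular_system_satisfiable)
    show "real (circuit_size D) \<ge> (real (card X) / real k) powr (1/2 * real k)"
      if "d_SDNNF_computes D \<tau> lam ?F" for D :: "(nat, nat) circuit" and \<tau> lam
      using powr_le_circulation_circuit_size[OF arc _ _ _ _ that, of k] k by (simp add: p_def)
    show "slim_for_OBDDs (1 * card X * k) c" if "c \<in> ?F" for c
      using slim_for_OBDDs_mono[OF slim_modular_system[OF X(1) p(1)] p(4)] that
      by (simp add: circulation_system_def)
  qed
qed simp

end
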